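(* Let $\boldsymbol{\varphi}_{\Delta t}(\boldsymbol{G},\boldsymbol{f})$ be the one-step exact flow map of the tensor-valued ODE $\frac{d\boldsymbol{f}}{dt}=\boldsymbol{G}(\boldsymbol{f})$, $\boldsymbol{f}(0)=\boldsymbol{f}_0$, on $\mathbb{R}^{n_1\times\cdots\times n_d}$, and let $\boldsymbol{\Phi}_{\Delta t}(\boldsymbol{G},\boldsymbol{f},\boldsymbol{e})$ be the increment function of a step-truncation method with truncation error thresholds $\boldsymbol{e}$. Suppose that the method has local error of order $p$, i.e., there is a constant $K$ such that $$\left\|\boldsymbol{\varphi}_{\Delta t}(\boldsymbol{G},\boldsymbol{f})-\boldsymbol{\Phi}_{\Delta t}(\boldsymbol{G},\boldsymbol{f},\boldsymbol{e})\right\|\leq K\Delta t^{p+1}\quad\text{as }\Delta t\to 0$$ for all tensors $\boldsymbol{f}$. If there exist truncation errors $\boldsymbol{e}=\boldsymbol{e}(\Delta t)$ (a function of $\Delta t$), for which the local error bound $\left\|\boldsymbol{\varphi}_{\Delta t}(\boldsymbol{G},\boldsymbol{f})-\boldsymbol{\Phi}_{\Delta t}(\boldsymbol{G},\boldsymbol{f},\boldsymbol{e})\right\|\leq K\Delta t^{p+1}$ holds for all tensors $\boldsymbol{f}$ as $\Delta t\to 0$, and constants $C,E>0$ (dependent on $\boldsymbol{G}$) so that the stability condition $$\left\|\boldsymbol{\Phi}_{\Delta t}(\boldsymbol{G},\hat{\boldsymbol{f}},\boldsymbol{e})-\boldsymbol{\Phi}_{\Delta t}(\boldsymbol{G},\tilde{\boldsymbol{f}},\boldsymbol{e})\right\|\leq(1+C\Delta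 t)\left\|\hat{\boldsymbol{f}}-\tilde{\boldsymbol{f}}\right\|+E\Delta t^{m+1}$$ holds for all tensors $\hat{\boldsymbol{f}},\tilde{\boldsymbol{f}}$ as $\Delta t\to 0$, then the step-truncation method is convergent with order $z=\min(m,p)$.
   Context: All tensors are elements of $\mathbb{R}^{n_1\times\cdots\times n_d}$ and $\|\cdot\|$ is the standard tensor 2-norm (or a weighted version of it). $\boldsymbol{G}:\mathbb{R}^{n_1\times\cdots\times n_d}\to\mathbb{R}^{n_1\times\cdots\times n_d}$ is such that the ODE has a well-defined flow on the time interval $[0,T]$ considered; $\boldsymbol{\varphi}_{t}(\boldsymbol{G},\boldsymbol{g})$ denotes the solution at time $t$ of the ODE started from $\boldsymbol{g}$. The orders $p,m$ are positive. A step-truncation method is a one-step scheme $\boldsymbol{f}_{k+1}=\boldsymbol{\Phi}_{\Delta t}(\boldsymbol{G},\boldsymbol{f}_k,\boldsymbol{e})$, $k=0,1,\ldots$, started at $\boldsymbol{f}_0$, on a uniform time grid with step $\Delta t>0$. Its increment function is a map $\boldsymbol{f}\mapsto\boldsymbol{\Phi}_{\Delta t}(\boldsymbol{G},\boldsymbol{f},\boldsymbol{e})$ from tensors to tensors, obtained from a conventional one-step time integrator by inserting truncations onto low-rank tensor manifolds; the vector $\boldsymbol{e}=(e_1,e_2,\ldots)$ collects the error thresholds used in these truncations. "As $\Delta t\to0$" means: for all sufficiently small $\Delta t>0$, with the constants $K,C,E$ independent of $\Delta t$. "Convergent with order $z$" means: for a fixed final time $T=N\Delta t$, there is a constant $Q$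 independent of $\Delta t$ (and $N$) such that $\left\|\boldsymbol{\varphi}_{T}(\boldsymbol{G},\boldsymbol{f}_0)-\boldsymbol{f}_N\right\|\leq Q\Delta t^{z}$ for all sufficiently small $\Delta t=T/N$. *)

theory Defs
  imports Complex_Main
begin

text \<open>An element of \<open>\<real>\<^bsup>n\<^sub>1 \<times> \<dots> \<times> n\<^sub>d\<^esup>\<close> is a function on multi-indices that
  vanishes outside the index set given by the list \<open>ns = [n\<^sub>1, \<dots>, n\<^sub>d]\<close>. With this convention
  pointwise subtraction of functions is subtraction of tensors.\<close>

type_synonym tensor = "nat list \<Rightarrow> real"

definition multi_indices :: "nat list \<Rightarrow> nat list set" where
  "multi_indices ns = listset (map (\<lambda>n. {1..n}) ns)"

definition tensors :: "nat list \<Rightarrow> tensor set" where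
  "tensors ns = {f. \<forall>i. i \<notin> multi_indices ns \<longrightarrow> f i = 0}"

text \<open>Weighted 2-norm; the constant weight \<open>w = (\<lambda>_. 1)\<close> gives the standard tensor 2-norm.\<close>

definition tensor_norm :: "nat list \<Rightarrow> (nat list \<Rightarrow> real) \<Rightarrow> tensor \<Rightarrow> real" where
  "tensor_norm ns w f = sqrt (\<Sum>i\<in>multi_indices ns. w i * (f i)\<^sup>2)"

text \<open>Solutions of \<open>df/dt = G(f)\<close>, \<open>f(0) = g\<close> on \<open>[0, T]\<close>. The derivative of a tensor-valued curve
  is taken entrywise, and one-sidedly at the end points of the interval.\<close>

definition ode_solution ::
  "nat list \<Rightarrow> (tensor \<Rightarrow> tensor) \<Rightarrow> real \<Rightarrow> tensor \<Rightarrow> (real \<Rightarrow> tensor) \<Rightarrow> bool" where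
  "ode_solution ns G T g y \<longleftrightarrow>
     y 0 = g \<and>
     (\<forall>t\<in>{0..T}. y t \<in> tensors ns \<and>
        (\<forall>i\<in>multi_indices ns.
           ((\<lambda>s. y s i) has_real_derivative G (y t) i) (at t within {0..T})))"

definition well_defined_flow :: "nat list \<Rightarrow> (tensor \<Rightarrow> tensor) \<Rightarrow> real \<Rightarrow> bool" where
  "well_defined_flow ns G T \<longleftrightarrow>
     (\<forall>g\<in>tensors ns. \<exists>y. ode_solution ns G T g y \<and>
        (\<forall>z. ode_solution ns G T g z \<longrightarrow> (\<forall>t\<in>{0..T}. z t = y t)))"

text \<open>The description is meaningful for \<open>0 \<le> t \<le> T\<close> whenever \<open>well_defined_flow ns G T\<close>: a solution
  on \<open>[0, t]\<close> can be continued to \<open>[0, T]\<close>, so uniqueness on \<open>[0, T]\<close> gives uniqueness on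
  \<open>[0, t]\<close>.\<close>

definition flow :: "nat list \<Rightarrow> real \<Rightarrow> (tensor \<Rightarrow> tensor) \<Rightarrow> tensor \<Rightarrow> tensor" where
  "flow ns t G g = (THE x. \<exists>y. ode_solution ns G t g y \<and> y t = x)"

text \<open>An increment function takes the step size, the right-hand side \<open>G\<close>, the current tensor and the
  vector of truncation error thresholds. The way the truncations enter a particular increment
  function is left open.\<close>

type_synonym increment =
  "real \<Rightarrow> (tensor \<Rightarrow> tensor) \<Rightarrow> tensor \<Rightarrow> (nat \<Rightarrow> real) \<Rightarrow> tensor"

primrec step_truncation ::
  "increment \<Rightarrow> (tensor \<Rightarrow> tensor) \<Rightarrow> real \<Rightarrow> (nat \<Rightarrow> real) \<Rightarrow> tensor \<Rightarrow> nat \<Rightarrow> tensor" where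
  "step_truncation \<Phi> G dt \<epsilon> f0 0 = f0"
| "step_truncation \<Phi> G dt \<epsilon> f0 (Suc k) = \<Phi> dt G (step_truncation \<Phi> G dt \<epsilon> f0 k) \<epsilon>"

definition local_error_order ::
  "nat list \<Rightarrow> (nat list \<Rightarrow> real) \<Rightarrow> increment \<Rightarrow> (tensor \<Rightarrow> tensor) \<Rightarrow> (real \<Rightarrow> nat \<Rightarrow> real)
    \<Rightarrow> real \<Rightarrow> bool" where
  "local_error_order ns w \<Phi> G e p \<longleftrightarrow>
     (\<exists>K. \<forall>\<^sub>F dt in at_right 0. \<forall>f\<in>tensors ns.
        tensor_norm ns w (flow ns dt G f - \<Phi> dt G f (e dt)) \<le> K * dt powr (p + 1))"

definition stability_condition ::
  "nat list \<Rightarrow> (nat list \<Rightarrow> real) \<Rightarrow> increment \<Rightarrow> (tensor \<Rightarrow> tensor) \<Rightarrow> (real \<Rightarrow> nat \<Rightarrow> real)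
    \<Rightarrow> real \<Rightarrow> bool" where
  "stability_condition ns w \<Phi> G e m \<longleftrightarrow>
     (\<exists>C>0. \<exists>E>0. \<forall>\<^sub>F dt in at_right 0. \<forall>f\<in>tensors ns. \<forall>g\<in>tensors ns.
        tensor_norm ns w (\<Phi> dt G f (e dt) - \<Phi> dt G g (e dt))
          \<le> (1 + C * dt) * tensor_norm ns w (f - g) + E * dt powr (m + 1))"

definition convergent_with_order ::
  "nat list \<Rightarrow> (nat list \<Rightarrow> real) \<Rightarrow> increment \<Rightarrow> (tensor \<Rightarrow> tensor) \<Rightarrow> (real \<Rightarrow> nat \<Rightarrow> real)
    \<Rightarrow> tensor \<Rightarrow> real \<Rightarrow> real \<Rightarrow> bool" where
  "convergent_with_order ns w \<Phi> G e f0 T z \<longleftrightarrow>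
     (\<exists>Q. \<forall>\<^sub>F dt in at_right 0. \<forall>N. T = real N * dt \<longrightarrow>
        tensor_norm ns w (flow ns T G f0 - step_truncation \<Phi> G dt (e dt) f0 N) \<le> Q * dt powr z)"

end

theory Submission
  imports Defs "HOL-Analysis.L2_Norm"
begin

text \<open>Compare the numerical solution with the exact solution \<open>y\<close> sampled at the grid points. Since
  the flow maps \<open>y (k dt)\<close> to \<open>y ((k + 1) dt)\<close>, splitting at \<open>\<Phi> (y (k dt))\<close> bounds the new error by
  the local error plus the stability estimate, so the errors satisfy
  \<open>a\<^sub>k\<^sub>+\<^sub>1 \<le> (1 + C dt) a\<^sub>k + O(dt\<^bsup>min m p + 1\<^esup>)\<close> with \<open>a\<^sub>0 = 0\<close>. After \<open>N = T / dt\<close> steps a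
  discrete Gronwall argument loses one power of \<open>dt\<close> and a factor \<open>exp (C T)\<close>.\<close>

text \<open>Absorbing \<open>sqrt (w i)\<close> into the entries turns the weighted norm into a
  Euclidean one, so that Minkowski's inequality yields the triangle inequality.\<close>

lemma tensor_norm_eq_L2_set:
  assumes "\<And>i. i \<in> multi_indices ns \<Longrightarrow> w i \<ge> 0"
  shows "tensor_norm ns w f = L2_set (\<lambda>i. sqrt (w i) * f i) (multi_indices ns)"
  unfolding tensor_norm_def L2_set_def
  using assms by (auto simp: power_mult_distrib intro!: arg_cong[of _ _ sqrt] sum.cong)


lemma tensor_norm_self [simp]: "tensor_norm ns w (f - f) = 0"
  by (simp add: tensor_norm_def)

lemma tensor_norm_triangle:
  assumes "\<And>i. i \<in> multi_indices ns \<Longrightarrow> w i \<ge> 0"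
  shows "tensor_norm ns w (f - h) \<le> tensor_norm ns w (f - g) + tensor_norm ns w (g - h)"
proof -
  have "(\<lambda>i. sqrt (w i) * (f - h) i)
      = (\<lambda>i. sqrt (w i) * (f - g) i + sqrt (w i) * (g - h) i)"
    by (auto simp: algebra_simps)
  then show ?thesis
    using L2_set_triangle_ineq[of "\<lambda>i. sqrt (w i) * (f - g) i" "\<lambda>i. sqrt (w i) * (g - h) i"]
    by (simp add: tensor_norm_eq_L2_set[OF assms])
qed

lemma ode_solution_tensors:
  "ode_solution ns G T g y \<Longrightarrow> t \<in> {0..T} \<Longrightarrow> y t \<in> tensors ns"
  by (simp add: ode_solution_def)

lemma ode_solution_initial: "ode_solution ns G T g y \<Longrightarrow> y 0 = g"
  by (simp add: ode_solution_def)

text \<open>The equation is autonomous, so translation in time preserves solutions. The case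
  \<open>t = 0\<close> is restriction to a shorter interval.\<close>

lemma ode_solution_shift:
  assumes y: "ode_solution ns G T g y" and t: "0 \<le> t" "t + h \<le> T"
  shows "ode_solution ns G h (y t) (\<lambda>s. y (t + s))"
  unfolding ode_solution_def
proof (intro conjI ballI)
  fix s i assume s: "s \<in> {0..h}" and i: "i \<in> multi_indices ns"
  have "((\<lambda>s. y s i) has_real_derivative G (y (t + s)) i) (at (t + s) within {0..T})"
    using y s i t by (auto simp: ode_solution_def)
  then have "((\<lambda>s. y s i) has_real_derivative G (y (t + s)) i) (at (t + s) within (+) t ` {0..h})"
    by (rule DERIV_subset) (use t in auto)
  then show "((\<lambda>s. y (t + s) i) has_real_derivative G (y (t + s)) i) (at s within {0..h})"
    by (simp only: DERIV_at_within_shift)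
next
  show "y (t + s) \<in> tensors ns" if "s \<in> {0..h}" for s
    using that t by (intro ode_solution_tensors[OF y]) auto
qed simp

text \<open>Away from \<open>a\<close> only one piece is visible near \<open>t\<close>; at
  \<open>a\<close> the left and right derivatives are both \<open>D\<close>.\<close>

lemma has_real_derivative_glue:
  fixes u v h :: "real \<Rightarrow> real"
  assumes u: "t \<le> a \<Longrightarrow> (u has_real_derivative D) (at t within {0..a})"
    and v: "a \<le> t \<Longrightarrow> (v has_real_derivative D) (at t within {a..b})"
    and hu: "\<And>s. s \<le> a \<Longrightarrow> h s = u s"
    and hv: "\<And>s. a \<le> s \<Longrightarrow> h s = v s"
    and t: "t \<in> {0..b}" and ab: "0 \<le> a" "a \<le> b"
  shows "(h has_real_derivative D) (at t within {0..b})"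
proof -
  have L: "(h has_real_derivative D) (at t within {0..a})" if "t \<le> a"
    by (rule has_field_derivative_transform_within[OF u zero_less_one])
      (use that t hu in auto)
  have R: "(h has_real_derivative D) (at t within {a..b})" if "a \<le> t"
    by (rule has_field_derivative_transform_within[OF v zero_less_one])
      (use that t hv in auto)
  consider "t < a" | "t > a" | "t = a" by linarith
  then show ?thesis
  proof cases
    case 1
    then have "at t within {0..b} = at t within {0..a}"
      using ab by (intro at_within_nhd[of _ "{..<a}"]) auto
    then show ?thesis using L 1 by simp
  next
    case 2
    then have "at t within {0..b} = at t within {a..b}"
      using ab by (intro at_within_nhd[of _ "{a<..}"]) auto
    then show ?thesis using R 2 by simp
  next
    case 3
    \<comment> \<open>At the joint the filter is the supremum of the two one-sided filters, and a
      limit along a supremum is a limit along both.\<close>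
    have "{0..b} = {0..a} \<union> {a..b}" using ab by auto
    then have "at t within {0..b} = sup (at t within {0..a}) (at t within {a..b})"
      by (simp only: at_within_union)
    with L R 3 show ?thesis
      unfolding has_field_derivative_iff by (simp add: filterlim_sup)
  qed
qed

text \<open>No kink arises at \<open>a\<close>: since \<open>v\<close> starts at \<open>u a\<close>,
  both one-sided derivatives there equal \<open>G (u a)\<close>.\<close>

lemma ode_solution_glue:
  assumes u: "ode_solution ns G a g u" and v: "ode_solution ns G b (u a) v"
    and ab: "0 \<le> a" "0 \<le> b"
  shows "ode_solution ns G (a + b) g (\<lambda>s. if s \<le> a then u s else v (s - a))"
    (is "ode_solution _ _ _ _ ?h")
  unfolding ode_solution_def
proof (intro conjI ballI)
  show "?h 0 = g" using u ab by (simp add: ode_solution_def)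
  show "?h t \<in> tensors ns" if "t \<in> {0..a + b}" for t
    using that ode_solution_tensors[OF u, of t] ode_solution_tensors[OF v, of "t - a"] by auto
next
  fix t i assume t: "t \<in> {0..a + b}" and i: "i \<in> multi_indices ns"
  \<comment> \<open>At \<open>s = a\<close> the conditional selects \<open>u\<close>, but
    \<open>v 0 = u a\<close> makes the other branch correct as well.\<close>
  have hv: "?h s = v (s - a)" if "a \<le> s" for s
    using that v by (auto simp: ode_solution_def)
  show "((\<lambda>s. ?h s i) has_real_derivative G (?h t) i) (at t within {0..a + b})"
  proof (rule has_real_derivative_glue[where a = a and u = "\<lambda>s. u s i" and v = "\<lambda>s. v (s - a) i"])
    show "((\<lambda>s. u s i) has_real_derivative G (?h t) i) (at t within {0..a})" if "t \<le> a"
      using u that t i by (auto simp: ode_solution_def)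
    show "((\<lambda>s. v (s - a) i) has_real_derivative G (?h t) i) (at t within {a..a + b})" if "a \<le> t"
    proof -
      have "((\<lambda>s. v s i) has_real_derivative G (v (t - a)) i)
          (at (- a + t) within (+) (- a) ` {a..a + b})"
        using v that t i unfolding image_add_atLeastAtMost by (auto simp: ode_solution_def)
      then have "((\<lambda>s. v (- a + s) i) has_real_derivative G (v (t - a)) i) (at t within {a..a + b})"
        by (simp only: DERIV_at_within_shift)
      moreover have "- a + s = s - a" for s by simp
      ultimately show ?thesis
        by (simp only: hv[OF that])
    qed
  qed (use t ab hv in auto)
qed

text \<open>Every solution on the short interval \<open>[0, h]\<close> is first extended to \<open>[0, T]\<close>, because uniqueness
  is only assumed there.\<close>

lemma flow_along_solution:
  assumes wd: "well_defined_flow ns G T" and y: "ode_solution ns G T g y"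
    and th: "0 \<le> t" "0 \<le> h" "t + h \<le> T"
  shows "flow ns h G (y t) = y (t + h)"
  unfolding flow_def
proof (rule the_equality)
  show "\<exists>z. ode_solution ns G h (y t) z \<and> z h = y (t + h)"
    using ode_solution_shift[OF y th(1,3)] by auto
next
  fix x assume "\<exists>z. ode_solution ns G h (y t) z \<and> z h = x"
  then obtain z where z: "ode_solution ns G h (y t) z" and x: "z h = x" by blast
  have g: "g \<in> tensors ns"
    using y th by (auto simp: ode_solution_def)
  have uniq: "z1 s = z2 s"
    if "ode_solution ns G T g z1" "ode_solution ns G T g z2" "s \<in> {0..T}" for z1 z2 s
    using wd that g unfolding well_defined_flow_def by metis
  \<comment> \<open>The competitor \<open>z\<close> is preceded by \<open>y\<close> on
    \<open>[0, t]\<close> and followed by a solution from \<open>z h\<close>. Starting at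
    \<open>g\<close> allows comparison with \<open>y\<close>, which already lives on all of
    \<open>[0, T]\<close>.\<close>
  have "ode_solution ns G t g y"
    using ode_solution_shift[OF y, of 0 t] th ode_solution_initial[OF y] by simp
  from ode_solution_glue[OF this z] th
  obtain u where u: "ode_solution ns G (t + h) g u" and uth: "u (t + h) = z h"
    using ode_solution_initial[OF z] by (auto split: if_splits)
  have "z h \<in> tensors ns"
    using z th by (auto intro: ode_solution_tensors)
  then obtain v0 where v0: "ode_solution ns G T (z h) v0"
    using wd unfolding well_defined_flow_def by blast
  have v: "ode_solution ns G (T - (t + h)) (u (t + h)) v0"
    using ode_solution_shift[OF v0, of 0 "T - (t + h)"] th ode_solution_initial[OF v0] uth by simp
  have "ode_solution ns G T g (\<lambda>s. if s \<le> t + h then u s else v0 (s - (t + h)))"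
    using ode_solution_glue[OF u v] th by simp
  from uniq[OF this y, of "t + h"] show "x = y (t + h)"
    using th x uth by simp
qed

text \<open>Each of the \<open>N\<close> defects \<open>b\<close> is amplified by at most
  \<open>(1 + c) ^ N\<close>, and \<open>1 + c \<le> exp c\<close>. Using the largest power for
  every defect, instead of summing the geometric series, avoids dividing by
  \<open>c\<close>.\<close>

lemma discrete_gronwall:
  fixes a :: "nat \<Rightarrow> real"
  assumes a0: "a 0 = 0" and c: "c \<ge> 0" and b: "b \<ge> 0"
    and step: "\<And>k. k < N \<Longrightarrow> a (Suc k) \<le> (1 + c) * a k + b"
  shows "a N \<le> real N * b * exp (c * real N)"
proof -
  have "k \<le> N \<Longrightarrow> a k \<le> real k * b * (1 + c) ^ k" for k
  proof (induction k)
    case (Suc k)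
    have "a (Suc k) \<le> (1 + c) * (real k * b * (1 + c) ^ k) + b"
      using Suc step[of k] c mult_left_mono[of "a k" "real k * b * (1 + c) ^ k" "1 + c"] by linarith
    \<comment> \<open>The new defect is enlarged by a factor at least 1 so that it carries the same
      power as the old ones.\<close>
    also have "\<dots> \<le> (1 + c) * (real k * b * (1 + c) ^ k) + b * (1 + c) ^ Suc k"
      using b c one_le_power[of "1 + c" "Suc k"] mult_left_mono[of 1 "(1 + c) ^ Suc k" b] by simp
    finally show ?case by (simp add: algebra_simps)
  qed (simp add: a0)
  from this[of N] have "a N \<le> real N * b * (1 + c) ^ N" by simp
  also have "(1 + c) ^ N \<le> exp c ^ N"
    using c by (intro power_mono) auto
  then have "real N * b * (1 + c) ^ N \<le> real N * b * exp (c * real N)"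
    using b by (intro mult_left_mono) (auto simp: exp_of_nat2_mult)
  finally show ?thesis .
qed

lemma step_truncation_tensors:
  assumes "\<And>f. f \<in> tensors ns \<Longrightarrow> \<Phi> dt G f \<epsilon> \<in> tensors ns" "f0 \<in> tensors ns"
  shows "step_truncation \<Phi> G dt \<epsilon> f0 k \<in> tensors ns"
  by (induction k) (use assms in auto)

theorem theorem1:
  fixes ns :: "nat list"
    and w :: "nat list \<Rightarrow> real"
    and G :: "tensor \<Rightarrow> tensor"
    and \<Phi> :: increment
    and e :: "real \<Rightarrow> nat \<Rightarrow> real"
    and f0 :: tensor
    and T p m :: real
  assumes weights: "\<And>i. i \<in> multi_indices ns \<Longrightarrow> w i > 0"
    and G_tensor: "\<And>f. f \<in> tensors ns \<Longrightarrow> G f \<in> tensors ns"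
    and final_time: "T > 0"
    and flow: "well_defined_flow ns G T"
    and \<Phi>_tensor: "\<And>dt f \<epsilon>. dt > 0 \<Longrightarrow> f \<in> tensors ns \<Longrightarrow> \<Phi> dt G f \<epsilon> \<in> tensors ns"
    and initial: "f0 \<in> tensors ns"
    and orders: "p > 0" "m > 0"
    and local_error: "local_error_order ns w \<Phi> G e p"
    and stability: "stability_condition ns w \<Phi> G e m"
  shows "convergent_with_order ns w \<Phi> G e f0 T (min m p)"
proof -
  have w: "w i \<ge> 0" if "i \<in> multi_indices ns" for i
    using weights[OF that] by simp
  define z where "z = min m p"
  obtain y where y: "ode_solution ns G T f0 y"
    using flow initial unfolding well_defined_flow_def by blast
  have flow_T: "flow ns T G f0 = y T"
    using flow_along_solution[OF flow y, of 0 T] final_time ode_solution_initial[OF y] by simp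
  obtain K where K: "\<forall>\<^sub>F dt in at_right 0. \<forall>f\<in>tensors ns.
      tensor_norm ns w (flow ns dt G f - \<Phi> dt G f (e dt)) \<le> K * dt powr (p + 1)"
    using local_error unfolding local_error_order_def by blast
  obtain C E where CE: "C > 0" "E > 0" and stab: "\<forall>\<^sub>F dt in at_right 0. \<forall>f\<in>tensors ns. \<forall>g\<in>tensors ns.
      tensor_norm ns w (\<Phi> dt G f (e dt) - \<Phi> dt G g (e dt))
        \<le> (1 + C * dt) * tensor_norm ns w (f - g) + E * dt powr (m + 1)"
    using stability unfolding stability_condition_def by blast
  \<comment> \<open>Below 1, powers of \<open>dt\<close> decrease in the exponent, so
    \<open>p + 1\<close> and \<open>m + 1\<close> may both be lowered to
    \<open>z + 1\<close>.\<close>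
  have small: "\<forall>\<^sub>F dt in at_right 0. 0 < dt \<and> dt < (1::real)"
    by (rule eventually_at_rightI[of 0 1]) auto
  show ?thesis
    unfolding convergent_with_order_def z_def[symmetric]
  proof (intro exI)
    \<comment> \<open>In this constant, \<open>\<bar>K\<bar> + E\<close> comes from the defect of
      one step, \<open>T\<close> from the number of steps and \<open>exp (C * T)\<close> from their
      amplification. The absolute value is there because \<open>K\<close> may be negative.\<close>
    show "\<forall>\<^sub>F dt in at_right 0. \<forall>N. T = real N * dt \<longrightarrow>
        tensor_norm ns w (flow ns T G f0 - step_truncation \<Phi> G dt (e dt) f0 N)
          \<le> T * (\<bar>K\<bar> + E) * exp (C * T) * dt powr z"
      using K stab small
    proof eventually_elim
      case (elim dt)
      then have dt: "0 < dt" "dt < 1" by auto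
      define b where "b = (\<bar>K\<bar> + E) * dt powr (z + 1)"
      have powr_le: "dt powr (p + 1) \<le> dt powr (z + 1)" "dt powr (m + 1) \<le> dt powr (z + 1)"
        using dt by (auto simp: z_def intro!: powr_mono')
      show ?case
      proof (intro allI impI)
        fix N assume N: "T = real N * dt"
        define s where "s = step_truncation \<Phi> G dt (e dt) f0"
        \<comment> \<open>The stability bound is available only between elements of
          \<open>tensors ns\<close>.\<close>
        have s: "s k \<in> tensors ns" for k
          unfolding s_def using \<Phi>_tensor dt initial by (intro step_truncation_tensors) auto
        define a where "a k = tensor_norm ns w (y (real k * dt) - s k)" for k
        have "a N \<le> real N * b * exp (C * dt * real N)"
        proof (rule discrete_gronwall)
          show "a 0 = 0"
            using ode_solution_initial[OF y] by (simp add: a_def s_def)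
          show "C * dt \<ge> 0" "b \<ge> 0" using CE dt by (auto simp: b_def)
          fix k assume "k < N"
          define t where "t = real k * dt"
          \<comment> \<open>Strictness of \<open>k < N\<close> keeps the whole step inside
            \<open>[0, T]\<close>, where \<open>y\<close> is a solution.\<close>
          have "real (Suc k) * dt \<le> real N * dt"
            using \<open>k < N\<close> dt by (intro mult_right_mono) auto
          then have t: "0 \<le> t" "t + dt \<le> T"
            using dt N by (auto simp: t_def algebra_simps)
          have yt: "y t \<in> tensors ns"
            using t dt by (intro ode_solution_tensors[OF y]) auto
          have exact: "y (real (Suc k) * dt) = flow ns dt G (y t)"
            using flow_along_solution[OF flow y, of t dt] t dt by (simp add: t_def algebra_simps)
          have "tensor_norm ns w (flow ns dt G (y t) - \<Phi> dt G (y t) (e dt)) \<le> K * dt powr (p + 1)"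
            using elim(1) yt by blast
          also have "\<dots> \<le> \<bar>K\<bar> * dt powr (z + 1)"
            using powr_le by (intro mult_mono) auto
          finally have loc: "tensor_norm ns w (flow ns dt G (y t) - \<Phi> dt G (y t) (e dt))
              \<le> \<bar>K\<bar> * dt powr (z + 1)" .
          have "tensor_norm ns w (\<Phi> dt G (y t) (e dt) - \<Phi> dt G (s k) (e dt))
              \<le> (1 + C * dt) * a k + E * dt powr (m + 1)"
            using elim(2) yt s by (auto simp: a_def t_def)
          also have "\<dots> \<le> (1 + C * dt) * a k + E * dt powr (z + 1)"
            using powr_le CE by (intro add_left_mono mult_left_mono) auto
          finally have sta: "tensor_norm ns w (\<Phi> dt G (y t) (e dt) - \<Phi> dt G (s k) (e dt))
              \<le> (1 + C * dt) * a k + E * dt powr (z + 1)" .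
          have "s (Suc k) = \<Phi> dt G (s k) (e dt)" by (simp add: s_def)
          then have "a (Suc k) \<le> tensor_norm ns w (flow ns dt G (y t) - \<Phi> dt G (y t) (e dt))
              + tensor_norm ns w (\<Phi> dt G (y t) (e dt) - \<Phi> dt G (s k) (e dt))"
            unfolding a_def exact by (simp only: tensor_norm_triangle[OF w])
          then show "a (Suc k) \<le> (1 + C * dt) * a k + b"
            using loc sta by (simp add: b_def algebra_simps)
        qed
        \<comment> \<open>One power of \<open>dt\<close> in \<open>b\<close> combines with
          \<open>N\<close> to give \<open>T\<close>, and the exponent becomes
          \<open>C * T\<close>.\<close>
        also have "real N * b * exp (C * dt * real N) = T * (\<bar>K\<bar> + E) * exp (C * T) * dt powr z"
          using dt by (simp add: N b_def powr_add mult_ac)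
        finally show "tensor_norm ns w (flow ns T G f0 - step_truncation \<Phi> G dt (e dt) f0 N)
            \<le> T * (\<bar>K\<bar> + E) * exp (C * T) * dt powr z"
          using flow_T N by (simp add: a_def s_def)
      qed
    qed
  qed
qed

end
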